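(* Let $(H,d)$ be a Hadamard space. For every $x\in H$ the mapping $\psi:\Gamma_x(H)\to H$, $\psi(\gamma):=\gamma(1)$, is a global isometry from $(\Gamma_x(H),d_1)$ onto $(H,d)$. Therefore the metric space $(\Gamma_x(H),d_1)$ is a Hadamard space for every $x\in H$.
   Context: A Hadamard space is a complete $\mathrm{CAT}(0)$ space. For $x\in H$, $\Gamma_x(H)$ is the set of all constant speed geodesics $\gamma:[0,1]\to H$ (i.e. $d(\gamma(s),\gamma(t))=|s-t|\,d(\gamma(0),\gamma(1))$ for all $s,t\in[0,1]$) with $\gamma(0)=x$. It is equipped with the metric $d_1(\gamma,\eta):=\sup_{t\in[0,1]}d(\gamma(t),\eta(t))$. *)

theory Defs
  imports "HOL-Analysis.Analysis"
begin

context Metric_space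
begin

text \<open>
  Geodesics are extensional on \<open>{0..1}\<close>, so that two of them are equal as HOL functions
  iff they agree on the unit interval.
\<close>
definition geodesic :: "(real \<Rightarrow> 'a) \<Rightarrow> bool" where
  "geodesic \<gamma> \<longleftrightarrow> \<gamma> \<in> {0..1} \<rightarrow>\<^sub>E M \<and>
     (\<forall>s\<in>{0..1}. \<forall>t\<in>{0..1}. d (\<gamma> s) (\<gamma> t) = \<bar>s - t\<bar> * d (\<gamma> 0) (\<gamma> 1))"

definition geodesics_from :: "'a \<Rightarrow> (real \<Rightarrow> 'a) set" where
  "geodesics_from x = {\<gamma>. geodesic \<gamma> \<and> \<gamma> 0 = x}"

text \<open>
  The library's sup metric on bounded functions. Geodesics are bounded, so between geodesics
  its value is the supremum of the pointwise distances (see \<open>geodesic_dist_eq_SUP\<close> below);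
  the default value 0 elsewhere is irrelevant.
\<close>
abbreviation geodesic_dist :: "(real \<Rightarrow> 'a) \<Rightarrow> (real \<Rightarrow> 'a) \<Rightarrow> real" where
  "geodesic_dist \<equiv> fdist {0..1}"

lemma geodesic_in_fspace:
  assumes "geodesic \<gamma>"
  shows "\<gamma> \<in> fspace {0..1}"
proof -
  have in_M: "\<gamma> t \<in> M" if "t \<in> {0..1}" for t
    using assms that by (auto simp: geodesic_def)
  have "\<gamma> t \<in> mcball (\<gamma> 0) (d (\<gamma> 0) (\<gamma> 1))" if t: "t \<in> {0..1}" for t
  proof -
    have "d (\<gamma> 0) (\<gamma> t) = \<bar>0 - t\<bar> * d (\<gamma> 0) (\<gamma> 1)"
      using assms t unfolding geodesic_def by (meson atLeastAtMost_iff order_refl zero_le_one)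
    also have "\<dots> \<le> 1 * d (\<gamma> 0) (\<gamma> 1)"
      by (rule mult_right_mono) (use t in simp_all)
    finally show ?thesis
      using in_M t by (simp add: in_mcball)
  qed
  then have "mbounded (\<gamma> ` {0..1})"
    unfolding mbounded_def by blast
  moreover have "\<gamma> \<in> extensional {0..1}"
    using assms by (simp add: geodesic_def PiE_def)
  ultimately show ?thesis
    using in_M by (simp add: fspace_def image_subset_iff)
qed

lemma geodesic_dist_eq_SUP:
  assumes "geodesic \<gamma>" "geodesic \<eta>"
  shows "geodesic_dist \<gamma> \<eta> = (SUP t\<in>{0..1}. d (\<gamma> t) (\<eta> t))"
  using assms by (simp add: fdist_def geodesic_in_fspace)

text \<open>
  A geodesic triangle has sides \<open>\<alpha>\<close>, \<open>\<beta>\<close>, \<open>\<gamma>\<close>, traversed cyclically, and \<open>p\<close>, \<open>q\<close>, \<open>r\<close> are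
  the vertices of a Euclidean comparison triangle, corresponding to \<open>\<alpha> 0\<close>, \<open>\<beta> 0\<close>, \<open>\<gamma> 0\<close>.
\<close>
definition comparison_triangle ::
    "(real \<Rightarrow> 'a) \<Rightarrow> (real \<Rightarrow> 'a) \<Rightarrow> (real \<Rightarrow> 'a) \<Rightarrow> real^2 \<Rightarrow> real^2 \<Rightarrow> real^2 \<Rightarrow> bool" where
  "comparison_triangle \<alpha> \<beta> \<gamma> p q r \<longleftrightarrow>
     geodesic \<alpha> \<and> geodesic \<beta> \<and> geodesic \<gamma> \<and>
     \<alpha> 1 = \<beta> 0 \<and> \<beta> 1 = \<gamma> 0 \<and> \<gamma> 1 = \<alpha> 0 \<and>
     dist p q = d (\<alpha> 0) (\<beta> 0) \<and> dist q r = d (\<beta> 0) (\<gamma> 0) \<and> dist r p = d (\<gamma> 0) (\<alpha> 0)"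

text \<open>All pairs of a point of the triangle (on any side) and a comparison point for it.\<close>
definition comparison_points ::
    "(real \<Rightarrow> 'a) \<Rightarrow> (real \<Rightarrow> 'a) \<Rightarrow> (real \<Rightarrow> 'a) \<Rightarrow> real^2 \<Rightarrow> real^2 \<Rightarrow> real^2 \<Rightarrow>
      ('a \<times> (real^2)) set" where
  "comparison_points \<alpha> \<beta> \<gamma> p q r =
     (\<lambda>t. (\<alpha> t, (1 - t) *\<^sub>R p + t *\<^sub>R q)) ` {0..1} \<union>
     (\<lambda>t. (\<beta> t, (1 - t) *\<^sub>R q + t *\<^sub>R r)) ` {0..1} \<union>
     (\<lambda>t. (\<gamma> t, (1 - t) *\<^sub>R r + t *\<^sub>R p)) ` {0..1}"

end

locale CAT0_space = Metric_space +
  assumes geodesic_exists: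
    "\<And>x y. \<lbrakk>x \<in> M; y \<in> M\<rbrakk> \<Longrightarrow> \<exists>\<gamma>. geodesic \<gamma> \<and> \<gamma> 0 = x \<and> \<gamma> 1 = y"
  assumes CAT0_inequality:
    "\<And>\<alpha> \<beta> \<gamma> p q r u u' v v'.
      \<lbrakk>comparison_triangle \<alpha> \<beta> \<gamma> p q r;
       (u, u') \<in> comparison_points \<alpha> \<beta> \<gamma> p q r; (v, v') \<in> comparison_points \<alpha> \<beta> \<gamma> p q r\<rbrakk>
      \<Longrightarrow> d u v \<le> dist u' v'"

locale Hadamard_space = CAT0_space +
  assumes complete: "mcomplete"

definition isometry_onto ::
    "'a set \<Rightarrow> ('a \<Rightarrow> 'a \<Rightarrow> real) \<Rightarrow> 'b set \<Rightarrow> ('b \<Rightarrow> 'b \<Rightarrow> real) \<Rightarrow> ('a \<Rightarrow> 'b) \<Rightarrow> bool" where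
  "isometry_onto M1 d1 M2 d2 f \<longleftrightarrow>
     f ` M1 = M2 \<and> (\<forall>x\<in>M1. \<forall>y\<in>M1. d2 (f x) (f y) = d1 x y)"

end

theory Submission
  imports Defs
begin

text \<open>
  Let \<open>\<gamma>\<close>, \<open>\<eta>\<close> be geodesics in a CAT(0) space with a common starting point \<open>x\<close>. Compare the
  triangle \<open>x\<close>, \<open>\<gamma> 1\<close>, \<open>\<eta> 1\<close> with a Euclidean one of the same side lengths. There the points at
  parameter \<open>t\<close> on two sides issuing from the same vertex are at distance \<open>t\<close> times the
  length of the opposite side, so the CAT(0) inequality gives
  \<open>d (\<gamma> t) (\<eta> t) \<le> t * d (\<gamma> 1) (\<eta> 1)\<close> (lemma \<open>geodesics_common_start_le\<close>). So the supremum
  of the pointwise distances is attained at \<open>t = 1\<close>, which says that evaluation at \<open>1\<close> preserves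
  distances. It is onto because every point is joined to \<open>x\<close> by a geodesic.

  The second claim follows because each part of the definition of a Hadamard space is phrased
  in terms of the metric and is therefore invariant under isometries
  (lemma \<open>Hadamard_space_isometric\<close>): geodesics, comparison triangles and their comparison
  points are pushed forward along the isometry, and the geodesics and limits that must exist are
  pulled back along its inverse.
\<close>

section \<open>Comparison triangles in the plane\<close>

text \<open>
  Put the first vertex at the origin and the second on the first coordinate axis. The law of
  cosines then dictates the first coordinate of the third vertex, and the triangle inequalities
  say exactly that the square of its second coordinate comes out nonnegative.
\<close>
lemma Euclidean_triangle_exists:
  fixes a b c :: real
  assumes "0 \<le> a" "0 \<le> b" "0 \<le> c" "a \<le> b + c" "b \<le> a + c" "c \<le> a + b"
  shows "\<exists>p q r :: real^2. dist p q = a \<and> dist q r = b \<and> dist r p = c"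
proof (cases "a = 0")
  case True
  then have "b = c"
    using assms by simp
  then have "dist (0::real^2) 0 = a \<and> dist 0 (vector [c, 0] :: real^2) = b \<and>
      dist (vector [c, 0] :: real^2) 0 = c"
    using True assms by (simp add: dist_vec_def L2_set_def sum_2)
  then show ?thesis
    by blast
next
  case False
  define x where "x = (a\<^sup>2 + c\<^sup>2 - b\<^sup>2) / (2 * a)"
  have x: "2 * a * x = a\<^sup>2 + c\<^sup>2 - b\<^sup>2"
    using False by (simp add: x_def)
  have "(a - c)\<^sup>2 \<le> b\<^sup>2"
    by (rule abs_le_square_iff[THEN iffD1]) (use assms in simp)
  moreover have "b\<^sup>2 \<le> (a + c)\<^sup>2"
    by (rule power_mono) (use assms in simp_all)
  ultimately have "\<bar>2 * a * x\<bar> \<le> 2 * a * c"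
    unfolding x abs_le_iff by (simp add: power2_eq_square algebra_simps)
  then have "\<bar>x\<bar> \<le> c"
    using False assms by (simp add: abs_mult)
  then have "x\<^sup>2 \<le> c\<^sup>2"
    using assms by (simp add: abs_le_square_iff[symmetric])
  then have y: "(sqrt (c\<^sup>2 - x\<^sup>2))\<^sup>2 = c\<^sup>2 - x\<^sup>2"
    by simp
  have "(a - x)\<^sup>2 + (c\<^sup>2 - x\<^sup>2) = b\<^sup>2"
    using x by (simp add: power2_eq_square algebra_simps)
  then have "dist (0::real^2) (vector [a, 0]) = a \<and>
      dist (vector [a, 0] :: real^2) (vector [x, sqrt (c\<^sup>2 - x\<^sup>2)]) = b \<and>
      dist (vector [x, sqrt (c\<^sup>2 - x\<^sup>2)] :: real^2) 0 = c"
    using assms y by (simp add: dist_vec_def L2_set_def sum_2 dist_real_def)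
  then show ?thesis
    by blast
qed

section \<open>Geodesics in a CAT(0) space\<close>

context Metric_space
begin

lemma geodesic_in_M: "geodesic \<gamma> \<Longrightarrow> t \<in> {0..1} \<Longrightarrow> \<gamma> t \<in> M"
  by (auto simp: geodesic_def)

lemma geodesic_reverse:
  assumes "geodesic \<gamma>"
  shows "geodesic (\<lambda>t\<in>{0..1}. \<gamma> (1 - t))"
proof -
  have "d (\<gamma> (1 - s)) (\<gamma> (1 - t)) = \<bar>s - t\<bar> * d (\<gamma> 1) (\<gamma> 0)"
    if "s \<in> {0..1}" "t \<in> {0..1}" for s t
  proof -
    have "1 - s \<in> {0..1}" "1 - t \<in> {0..1}"
      using that by auto
    then have "d (\<gamma> (1 - s)) (\<gamma> (1 - t)) = \<bar>(1 - s) - (1 - t)\<bar> * d (\<gamma> 0) (\<gamma> 1)"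
      using assms unfolding geodesic_def by blast
    then show ?thesis
      by (simp add: commute abs_minus_commute)
  qed
  then show ?thesis
    using geodesic_in_M[OF assms] by (auto simp: geodesic_def)
qed

lemma comparison_triangle_exists:
  assumes "geodesic \<alpha>" "geodesic \<beta>" "geodesic \<gamma>"
    and "\<alpha> 1 = \<beta> 0" "\<beta> 1 = \<gamma> 0" "\<gamma> 1 = \<alpha> 0"
  shows "\<exists>p q r. comparison_triangle \<alpha> \<beta> \<gamma> p q r"
proof -
  have M: "\<alpha> 0 \<in> M" "\<beta> 0 \<in> M" "\<gamma> 0 \<in> M"
    using assms by (auto intro: geodesic_in_M)
  have "\<exists>p q r :: real^2. dist p q = d (\<alpha> 0) (\<beta> 0) \<and> dist q r = d (\<beta> 0) (\<gamma> 0) \<and>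
      dist r p = d (\<gamma> 0) (\<alpha> 0)"
    using triangle[OF M(1) M(3) M(2)] triangle[OF M(2) M(1) M(3)] triangle[OF M(3) M(2) M(1)]
    by (intro Euclidean_triangle_exists) (simp_all add: commute)
  then show ?thesis
    using assms by (simp add: comparison_triangle_def)
qed

end

text \<open>
  Convexity of the metric along two geodesics with the same origin. In the comparison triangle the
  two points at parameter \<open>t\<close> are the images of the far vertices under the homothety of ratio
  \<open>t\<close> centred at the common vertex.
\<close>
lemma (in CAT0_space) geodesics_common_start_le:
  assumes \<gamma>: "geodesic \<gamma>" and \<eta>: "geodesic \<eta>" and start: "\<gamma> 0 = \<eta> 0" and t: "t \<in> {0..1}"
  shows "d (\<gamma> t) (\<eta> t) \<le> t * d (\<gamma> 1) (\<eta> 1)"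
proof -
  obtain \<beta> where \<beta>: "geodesic \<beta>" "\<beta> 0 = \<gamma> 1" "\<beta> 1 = \<eta> 1"
    using geodesic_exists[of "\<gamma> 1" "\<eta> 1"] geodesic_in_M \<gamma> \<eta> by fastforce
  \<comment> \<open>The sides of a triangle are traversed cyclically, so the third one runs back to the start.\<close>
  let ?\<rho> = "\<lambda>t\<in>{0..1}. \<eta> (1 - t)"
  obtain p q r where tri: "comparison_triangle \<gamma> \<beta> ?\<rho> p q r"
    using comparison_triangle_exists[OF \<gamma> \<beta>(1) geodesic_reverse[OF \<eta>]] \<beta> start by auto
  have "(\<gamma> t, (1 - t) *\<^sub>R p + t *\<^sub>R q) \<in> comparison_points \<gamma> \<beta> ?\<rho> p q r"
    using t by (auto simp: comparison_points_def)
  moreover have "(\<eta> t, t *\<^sub>R r + (1 - t) *\<^sub>R p) \<in> comparison_points \<gamma> \<beta> ?\<rho> p q r"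
    unfolding comparison_points_def
    by (rule UnI2, rule image_eqI[where x = "1 - t"]) (use t in auto)
  ultimately have "d (\<gamma> t) (\<eta> t) \<le>
      dist ((1 - t) *\<^sub>R p + t *\<^sub>R q) (t *\<^sub>R r + (1 - t) *\<^sub>R p)"
    by (rule CAT0_inequality[OF tri])
  also have "\<dots> = dist (t *\<^sub>R q) (t *\<^sub>R r)"
    by (simp add: dist_norm algebra_simps)
  also have "\<dots> = t * dist q r"
    using t by (simp add: dist_norm flip: scaleR_right_diff_distrib)
  also have "dist q r = d (\<gamma> 1) (\<eta> 1)"
    using tri \<beta> by (simp add: comparison_triangle_def)
  finally show ?thesis .
qed

context CAT0_space
begin

lemma geodesic_dist_common_start:
  assumes "geodesic \<gamma>" "geodesic \<eta>" "\<gamma> 0 = \<eta> 0"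
  shows "geodesic_dist \<gamma> \<eta> = d (\<gamma> 1) (\<eta> 1)"
proof -
  have "d (\<gamma> t) (\<eta> t) \<le> d (\<gamma> 1) (\<eta> 1)" if t: "t \<in> {0..1}" for t
  proof -
    have "t * d (\<gamma> 1) (\<eta> 1) \<le> d (\<gamma> 1) (\<eta> 1)"
      using t by (simp add: mult_left_le_one_le)
    with geodesics_common_start_le[OF assms t] show ?thesis
      by (rule order_trans)
  qed
  then have "(SUP t\<in>{0..1}. d (\<gamma> t) (\<eta> t)) = d (\<gamma> 1) (\<eta> 1)"
    by (intro cSup_eq_maximum) auto
  with geodesic_dist_eq_SUP[OF assms(1,2)] show ?thesis
    by (rule trans)
qed

lemma geodesic_endpoint_isometry:
  assumes "x \<in> M"
  shows "isometry_onto (geodesics_from x) geodesic_dist M d (\<lambda>\<gamma>. \<gamma> 1)"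
proof -
  have "(\<lambda>\<gamma>. \<gamma> 1) ` geodesics_from x = M"
  proof
    show "(\<lambda>\<gamma>. \<gamma> 1) ` geodesics_from x \<subseteq> M"
      by (auto simp: geodesics_from_def intro: geodesic_in_M)
    show "M \<subseteq> (\<lambda>\<gamma>. \<gamma> 1) ` geodesics_from x"
      using geodesic_exists[OF assms] by (force simp: geodesics_from_def)
  qed
  then show ?thesis
    by (auto simp: isometry_onto_def geodesics_from_def geodesic_dist_common_start)
qed

end

lemma (in Metric_space) Metric_space_geodesics_from:
  "Metric_space (geodesics_from x) geodesic_dist"
  \<comment> \<open>Geodesics are bounded, hence form a subspace of the bounded functions with the sup metric.\<close>
  by (rule Metric_space.subspace[OF Metric_space_funspace])
    (auto simp: geodesics_from_def geodesic_in_fspace)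

section \<open>Invariance of Hadamard spaces under isometries\<close>

lemma isometry_onto_inj_on:
  assumes "Metric_space M1 d1" "Metric_space M2 d2" "isometry_onto M1 d1 M2 d2 f"
  shows "inj_on f M1"
proof (rule inj_onI)
  fix x y
  assume xy: "x \<in> M1" "y \<in> M1" "f x = f y"
  then have "f y \<in> M2"
    using assms(3) by (auto simp: isometry_onto_def)
  then have "d2 (f x) (f y) = 0"
    using xy Metric_space.zero[OF assms(2)] by simp
  then have "d1 x y = 0"
    using xy(1,2) assms(3) by (simp add: isometry_onto_def)
  then show "x = y"
    using xy(1,2) Metric_space.zero[OF assms(1)] by blast
qed

lemma isometry_onto_inv_into:
  assumes "Metric_space M1 d1" "Metric_space M2 d2" "isometry_onto M1 d1 M2 d2 f"
  shows "isometry_onto M2 d2 M1 d1 (inv_into M1 f)"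
proof -
  have f: "f ` M1 = M2"
    using assms(3) by (simp add: isometry_onto_def)
  have "inv_into M1 f ` M2 = M1"
    using inv_into_image_cancel[OF isometry_onto_inj_on[OF assms] order_refl] f by simp
  moreover have "d1 (inv_into M1 f u) (inv_into M1 f v) = d2 u v" if "u \<in> M2" "v \<in> M2" for u v
  proof -
    obtain x y where "x \<in> M1" "y \<in> M1" "u = f x" "v = f y"
      using \<open>u \<in> M2\<close> \<open>v \<in> M2\<close> unfolding f[symmetric] by blast
    then show ?thesis
      using assms(3) by (simp add: isometry_onto_def isometry_onto_inj_on[OF assms])
  qed
  ultimately show ?thesis
    by (simp add: isometry_onto_def)
qed

lemma isometry_onto_geodesic:
  assumes "Metric_space M1 d1" "Metric_space M2 d2" "isometry_onto M1 d1 M2 d2 f"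
    and "Metric_space.geodesic M1 d1 \<gamma>"
  shows "Metric_space.geodesic M2 d2 (\<lambda>t\<in>{0..1}. f (\<gamma> t))"
proof -
  have M1: "\<gamma> t \<in> M1" if "t \<in> {0..1}" for t
    using Metric_space.geodesic_in_M[OF assms(1,4) that] .
  have isom: "d2 (f (\<gamma> s)) (f (\<gamma> t)) = d1 (\<gamma> s) (\<gamma> t)" if "s \<in> {0..1}" "t \<in> {0..1}" for s t
    using assms(3) M1[OF that(1)] M1[OF that(2)] by (simp add: isometry_onto_def)
  let ?\<delta> = "\<lambda>t\<in>{0..1}. f (\<gamma> t)"
  have "?\<delta> \<in> {0..1} \<rightarrow>\<^sub>E M2"
    using assms(3) M1 by (auto simp: isometry_onto_def)
  moreover have "d2 (?\<delta> s) (?\<delta> t) = \<bar>s - t\<bar> * d2 (?\<delta> 0) (?\<delta> 1)"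
    if "s \<in> {0..1}" "t \<in> {0..1}" for s t
  proof -
    have "d1 (\<gamma> s) (\<gamma> t) = \<bar>s - t\<bar> * d1 (\<gamma> 0) (\<gamma> 1)"
      using assms(4) that unfolding Metric_space.geodesic_def[OF assms(1)] by blast
    moreover have "d2 (f (\<gamma> 0)) (f (\<gamma> 1)) = d1 (\<gamma> 0) (\<gamma> 1)"
      by (rule isom) simp_all
    ultimately show ?thesis
      using isom[OF that] that by simp
  qed
  ultimately show ?thesis
    unfolding Metric_space.geodesic_def[OF assms(2)] by blast
qed

text \<open>
  An isometry preserves the side lengths of a triangle, so the same plane triangle serves for the
  image, with the same comparison points.
\<close>
lemma isometry_onto_comparison_triangle:
  assumes "Metric_space M1 d1" "Metric_space M2 d2" "isometry_onto M1 d1 M2 d2 f"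
    and "Metric_space.comparison_triangle M1 d1 \<alpha> \<beta> \<gamma> p q r"
  shows "Metric_space.comparison_triangle M2 d2
    (\<lambda>t\<in>{0..1}. f (\<alpha> t)) (\<lambda>t\<in>{0..1}. f (\<beta> t)) (\<lambda>t\<in>{0..1}. f (\<gamma> t)) p q r"
proof -
  note tri = assms(4)[unfolded Metric_space.comparison_triangle_def[OF assms(1)]]
  have "\<alpha> 0 \<in> M1" "\<beta> 0 \<in> M1" "\<gamma> 0 \<in> M1"
    using tri Metric_space.geodesic_in_M[OF assms(1)] by auto
  then show ?thesis
    using tri isometry_onto_geodesic[OF assms(1-3)] assms(3)
    by (simp add: Metric_space.comparison_triangle_def[OF assms(2)] isometry_onto_def)
qed

lemma comparison_points_map:
  fixes M1 :: "'a set" and M2 :: "'b set" and f :: "'a \<Rightarrow> 'b"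
  assumes "Metric_space M1 d1" "Metric_space M2 d2"
    and "(u, u') \<in> Metric_space.comparison_points \<alpha> \<beta> \<gamma> p q r"
  shows "(f u, u') \<in> Metric_space.comparison_points
    (\<lambda>t\<in>{0..1}. f (\<alpha> t)) (\<lambda>t\<in>{0..1}. f (\<beta> t)) (\<lambda>t\<in>{0..1}. f (\<gamma> t)) p q r"
proof -
  have "Metric_space.comparison_points
      (\<lambda>t\<in>{0..1}. f (\<alpha> t)) (\<lambda>t\<in>{0..1}. f (\<beta> t)) (\<lambda>t\<in>{0..1}. f (\<gamma> t)) p q r =
      map_prod f id ` Metric_space.comparison_points \<alpha> \<beta> \<gamma> p q r"
    by (simp add: Metric_space.comparison_points_def[OF assms(1)]
        Metric_space.comparison_points_def[OF assms(2)] image_Un image_image cong: image_cong_simp)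
  moreover have "map_prod f id (u, u') \<in>
      map_prod f id ` Metric_space.comparison_points \<alpha> \<beta> \<gamma> p q r"
    using assms(3) by (rule imageI)
  ultimately show ?thesis
    by simp
qed

text \<open>
  Existence of geodesics is pulled back from \<open>M2\<close> along the inverse isometry, whereas a triangle
  in \<open>M1\<close> is pushed forward to inherit the CAT(0) inequality from its image.
\<close>
lemma CAT0_space_isometric:
  assumes "Metric_space M1 d1" "CAT0_space M2 d2" "isometry_onto M1 d1 M2 d2 f"
  shows "CAT0_space M1 d1"
proof -
  interpret M1: Metric_space M1 d1 by fact
  interpret M2: CAT0_space M2 d2 by fact
  note iso = M1.Metric_space_axioms M2.Metric_space_axioms assms(3)
  have f: "f x \<in> M2" "inv_into M1 f (f x) = x" if "x \<in> M1" for x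
    using assms(3) isometry_onto_inj_on[OF iso] that by (auto simp: isometry_onto_def)
  show ?thesis
  proof
    fix x y
    assume xy: "x \<in> M1" "y \<in> M1"
    then obtain \<gamma> where \<gamma>: "M2.geodesic \<gamma>" "\<gamma> 0 = f x" "\<gamma> 1 = f y"
      using M2.geodesic_exists f(1) by blast
    have "M1.geodesic (\<lambda>t\<in>{0..1}. inv_into M1 f (\<gamma> t))"
      by (rule isometry_onto_geodesic[OF iso(2,1) isometry_onto_inv_into[OF iso] \<gamma>(1)])
    then show "\<exists>\<gamma>. M1.geodesic \<gamma> \<and> \<gamma> 0 = x \<and> \<gamma> 1 = y"
      using \<gamma> xy f(2) by (intro exI[of _ "\<lambda>t\<in>{0..1}. inv_into M1 f (\<gamma> t)"]) simp
  next
    fix \<alpha> \<beta> \<gamma> p q r u u' v v'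
    assume tri: "M1.comparison_triangle \<alpha> \<beta> \<gamma> p q r"
      and u: "(u, u') \<in> M1.comparison_points \<alpha> \<beta> \<gamma> p q r"
      and v: "(v, v') \<in> M1.comparison_points \<alpha> \<beta> \<gamma> p q r"
    have "M1.geodesic \<alpha>" "M1.geodesic \<beta>" "M1.geodesic \<gamma>"
      using tri by (simp_all add: M1.comparison_triangle_def)
    then have "u \<in> M1" "v \<in> M1"
      using u v unfolding M1.comparison_points_def by (auto intro: M1.geodesic_in_M)
    then have "d1 u v = d2 (f u) (f v)"
      using assms(3) by (simp add: isometry_onto_def)
    also have "\<dots> \<le> dist u' v'"
      by (rule M2.CAT0_inequality[OF isometry_onto_comparison_triangle[OF iso tri]
            comparison_points_map[OF iso(1,2) u] comparison_points_map[OF iso(1,2) v]])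
    finally show "d1 u v \<le> dist u' v'" .
  qed
qed

lemma mcomplete_isometric:
  assumes "Metric_space M1 d1" "Metric_space M2 d2" "isometry_onto M1 d1 M2 d2 f"
    and "Metric_space.mcomplete M2 d2"
  shows "Metric_space.mcomplete M1 d1"
proof -
  interpret M1: Metric_space M1 d1 by fact
  interpret M2: Metric_space M2 d2 by fact
  have f: "d2 (f x) (f y) = d1 x y" if "x \<in> M1" "y \<in> M1" for x y
    using assms(3) that by (simp add: isometry_onto_def)
  show ?thesis
    unfolding M1.mcomplete_def
  proof (intro allI impI)
    fix \<sigma>
    assume \<sigma>: "M1.MCauchy \<sigma>"
    then have \<sigma>_in: "\<sigma> n \<in> M1" for n
      by (auto simp: M1.MCauchy_def)
    then have "range (f \<circ> \<sigma>) \<subseteq> M2"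
      using assms(3) by (auto simp: isometry_onto_def)
    then have "M2.MCauchy (f \<circ> \<sigma>)"
      using \<sigma> by (simp add: M1.MCauchy_def M2.MCauchy_def f \<sigma>_in)
    then obtain y where y: "limitin M2.mtopology (f \<circ> \<sigma>) y sequentially"
      using assms(4) by (auto simp: M2.mcomplete_def)
    then have "y \<in> M2"
      by (simp add: M2.limitin_metric_dist_null)
    then obtain x where "x \<in> M1" "y = f x"
      using assms(3) by (auto simp: isometry_onto_def)
    then have "limitin M1.mtopology \<sigma> x sequentially"
      using y by (simp add: M1.limitin_metric_dist_null M2.limitin_metric_dist_null f \<sigma>_in)
    then show "\<exists>x. limitin M1.mtopology \<sigma> x sequentially" ..
  qed
qed

lemma Hadamard_space_isometric:
  assumes "Metric_space M1 d1" "Hadamard_space M2 d2" "isometry_onto M1 d1 M2 d2 f"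
  shows "Hadamard_space M1 d1"
proof -
  interpret M2: Hadamard_space M2 d2 by fact
  show ?thesis
    using CAT0_space_isometric[OF assms(1) M2.CAT0_space_axioms assms(3)]
      mcomplete_isometric[OF assms(1) M2.Metric_space_axioms assms(3) M2.complete]
    by (intro Hadamard_space.intro Hadamard_space_axioms.intro)
qed

section \<open>The space of geodesics issuing from a point\<close>

theorem theorem10:
  fixes H :: "'a set" and d :: "'a \<Rightarrow> 'a \<Rightarrow> real"
  assumes "Hadamard_space H d"
  shows "\<forall>x\<in>H.
    isometry_onto (Metric_space.geodesics_from H d x) (Metric_space.geodesic_dist H d) H d
      (\<lambda>\<gamma>. \<gamma> 1) \<and>
    Hadamard_space (Metric_space.geodesics_from H d x) (Metric_space.geodesic_dist H d)"
proof
  fix x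
  assume "x \<in> H"
  interpret Hadamard_space H d by fact
  have iso: "isometry_onto (geodesics_from x) geodesic_dist H d (\<lambda>\<gamma>. \<gamma> 1)"
    using \<open>x \<in> H\<close> by (rule geodesic_endpoint_isometry)
  moreover have "Hadamard_space (geodesics_from x) geodesic_dist"
    by (rule Hadamard_space_isometric[OF Metric_space_geodesics_from assms iso])
  ultimately show "isometry_onto (geodesics_from x) geodesic_dist H d (\<lambda>\<gamma>. \<gamma> 1) \<and>
      Hadamard_space (geodesics_from x) geodesic_dist" ..
qed

end
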